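(* Let $(V,\|\cdot\|)$ be a normed vector space, let $\Theta\subseteq V$ be convex, let $\varepsilon>0$, and let $m$ and $k$ be integers with $1\le k\le m$. If each expert returns a ranking of her top $k$ candidates, then there exists a universal committee $E$ of experts in $\Theta$ of size $$\left(\frac{8(m-1)}{k}+1\right)\bigl(N(\Theta,\|\cdot\|,\varepsilon/2)-1\bigr)$$ such that for any set of $m$ candidates in $\Theta$ (any locations in $\Theta$ and any real qualities), the regret of selecting the minimal regret candidate is at most $\varepsilon$.
   Context: Model. There are $m$ candidates $[m]=\{1,\dots,m\}$; candidate $j$ has a location $c_j\in\Theta$ (locations may coincide) and a quality $q_j\in\mathbb{R}$. A committee is a finite list $E=\{e_1,\dots,e_n\}$ of expert locations in $\Theta$ (its size is $n$); "universal" means that it is fixed before, and independently of, the candidates. Write $d(x,y)=\|x-y\|$. Given the qualities, expert $i$ reports a ranking $\succ_i^k$ of her top $k$ candidates: for $h=1,\dots,k$, $\succ_i^k(h)\in\arg\max_{j\in[m]\setminus\{\succ_i^k(1),\dots,\succ_i^k(h-1)\}}\, q_j-d(e_i,c_j)$, with ties broken arbitrarily. Write $j\succ_i^k j'$ if $j$ appears in expert $i$'s list and $j'$ either appears later in the list or does not appear in it. A vector $\hat q\in\mathbb{R}^m$ is consistent with $\succ^k=\{\succ_i^k\}_{i\in[n]}$ if $\hat q_j-d(e_i,c_j)\ge \hat q_{j'}-d(e_i,c_{j'})$ whenever $j\succ_i^k j'$. Minimal regret candidate. Given the candidate locations, expert locations and reported rankings (but not $q$), a minimal regret candidate is a $g\in[m]$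 minimizing $\max_{h\ne g}\ \sup\{\hat q_h-\hat q_g : \hat q\in\mathbb{R}^m \text{ consistent with } \succ^k\}$. Regret. The regret of selecting candidate $j^*$ is $\max_{j\in[m]}q_j-q_{j^*}$, where $q$ is the true quality vector. Covering number. $N(\Theta,\|\cdot\|,\delta)$ is the minimum size of an (internal) $\delta$-cover of $\Theta$, i.e. of a set $X\subseteq\Theta$ such that every $\theta\in\Theta$ has some $x\in X$ with $\|\theta-x\|\le\delta$.
   Formalization: The covering number N is assumed finite, the committee size is rounded down to an integer, and the case N = 1 with m ≥ 2 is excluded: there the stated size is 0, every candidate is a minimal regret candidate, and the claim is false. *)

theory Defs
  imports "HOL-Analysis.Analysis"
begin

text \<open>
  Candidates are the indices \<open>{1..m}\<close>; vectors indexed by candidates (locations \<open>c\<close>, qualities \<open>q\<close>)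
  are functions on \<^typ>\<open>nat\<close> of which only the values on \<open>{1..m}\<close> are used.  A committee is a list
  \<open>E\<close> of expert locations, and \<open>R i\<close> is the ranking reported by the expert at \<open>E ! i\<close>.
\<close>

definition is_cover :: "'a::real_normed_vector set \<Rightarrow> real \<Rightarrow> 'a set \<Rightarrow> bool" where
  "is_cover \<Theta> \<delta> X \<longleftrightarrow> X \<subseteq> \<Theta> \<and> (\<forall>\<theta>\<in>\<Theta>. \<exists>x\<in>X. dist \<theta> x \<le> \<delta>)"

text \<open>The value is \<open>\<infinity>\<close> when there is no finite cover.\<close>

definition covering_number :: "'a::real_normed_vector set \<Rightarrow> real \<Rightarrow> enat" where
  "covering_number \<Theta> \<delta> = (INF X\<in>{X. finite X \<and> is_cover \<Theta> \<delta> X}. enat (card X))"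

text \<open>
  The list \<open>r\<close> is a possible report of her top \<open>k\<close> candidates by an expert at \<open>e\<close>; when several
  candidates attain the maximum, each choice gives an admissible report.
\<close>

definition is_top_ranking ::
  "nat \<Rightarrow> nat \<Rightarrow> (nat \<Rightarrow> 'a::real_normed_vector) \<Rightarrow> (nat \<Rightarrow> real) \<Rightarrow> 'a \<Rightarrow> nat list \<Rightarrow> bool" where
  "is_top_ranking m k c q e r \<longleftrightarrow> length r = k \<and>
     (\<forall>h<k. is_arg_max (\<lambda>j. q j - dist e (c j)) (\<lambda>j. j \<in> {1..m} - set (take h r)) (r ! h))"

definition ranked_above :: "nat list \<Rightarrow> nat \<Rightarrow> nat \<Rightarrow> bool" where
  "ranked_above r j j' \<longleftrightarrow> (\<exists>h<length r. r ! h = j \<and>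
     ((\<exists>h'<length r. h < h' \<and> r ! h' = j') \<or> j' \<notin> set r))"

definition consistent ::
  "nat \<Rightarrow> (nat \<Rightarrow> 'a::real_normed_vector) \<Rightarrow> 'a list \<Rightarrow> (nat \<Rightarrow> nat list) \<Rightarrow> (nat \<Rightarrow> real) \<Rightarrow> bool" where
  "consistent m c E R q' \<longleftrightarrow>
     (\<forall>i<length E. \<forall>j\<in>{1..m}. \<forall>j'\<in>{1..m}. ranked_above (R i) j j' \<longrightarrow>
        q' j - dist (E ! i) (c j) \<ge> q' j' - dist (E ! i) (c j'))"

text \<open>
  The suprema are taken in the extended reals: the inner one is \<open>\<infinity>\<close> when the reports do not bound
  \<open>q' h - q' g\<close>.  The outer one is the maximum of a finite family, which is empty only for \<open>m = 1\<close>,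
  where there is a single candidate to choose from.
\<close>

definition worst_case_regret ::
  "nat \<Rightarrow> (nat \<Rightarrow> 'a::real_normed_vector) \<Rightarrow> 'a list \<Rightarrow> (nat \<Rightarrow> nat list) \<Rightarrow> nat \<Rightarrow> ereal" where
  "worst_case_regret m c E R g =
     (SUP h\<in>{1..m} - {g}. SUP q'\<in>{q'. consistent m c E R q'}. ereal (q' h - q' g))"

definition minimal_regret_candidate ::
  "nat \<Rightarrow> (nat \<Rightarrow> 'a::real_normed_vector) \<Rightarrow> 'a list \<Rightarrow> (nat \<Rightarrow> nat list) \<Rightarrow> nat \<Rightarrow> bool" where
  "minimal_regret_candidate m c E R g \<longleftrightarrow>
     is_arg_min (worst_case_regret m c E R) (\<lambda>j. j \<in> {1..m}) g"

definition regret :: "nat \<Rightarrow> (nat \<Rightarrow> real) \<Rightarrow> nat \<Rightarrow> real" where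
  "regret m q g = Max (q ` {1..m}) - q g"

end

theory Submission
  imports Defs
begin

text \<open>
  Two neighbouring experts, at distance at most \<open>\<delta>\<close>, that disagree on the order of two candidates
  \<open>a\<close>, \<open>b\<close> reveal \<open>q a - q b\<close> up to an error \<open>\<delta>\<close>; call such candidates linked.  When the experts are
  \<open>\<delta>\<close>-chained together, following the lists that contain a top candidate \<open>a\<close> shows that \<open>a\<close> is
  linked either to all top candidates or to the whole list of some expert, hence to at least \<open>k\<close>
  others.  A maximal family of \<open>s\<close> top candidates with disjoint closed neighbourhoods, grown along
  links, therefore has \<open>s (k + 1) \<le> m\<close>, and it reveals the qualities of all top candidates, up to a
  common shift, with error \<open>(3 (s - 1) + 4) \<delta>\<close> on differences.  The best top candidate \<open>g\<close> for this
  estimate loses at most this error to any top candidate, and any candidate loses at most \<open>\<epsilon> / 2\<close>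
  to the top candidate of the nearest expert in the cover.

  As \<open>\<Theta>\<close> is connected, the points of an optimal cover are joined by a tree with \<open>N - 1\<close> edges of
  length at most \<open>\<epsilon>\<close>; the experts subdivide each edge into \<open>\<lfloor>8 (m - 1) / k\<rfloor>\<close> equal parts.
\<close>

section \<open>Chained sets of points\<close>

text \<open>Connectivity of the graph that joins points at distance at most \<delta>, stated by cuts
  instead of paths: its uses take the set treated so far and need one edge leaving it.\<close>

definition chained :: "real \<Rightarrow> 'a::metric_space set \<Rightarrow> bool" where
  "chained \<delta> S \<longleftrightarrow> (\<forall>B\<subseteq>S. B \<noteq> {} \<longrightarrow> B \<noteq> S \<longrightarrow> (\<exists>a\<in>B. \<exists>b\<in>S - B. dist a b \<le> \<delta>))"

lemma chained_singleton: "chained \<delta> {x}"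
  by (auto simp: chained_def)

lemma chained_insert:
  assumes "chained \<delta> S" "a \<in> S" "dist a b \<le> \<delta>"
  shows "chained \<delta> (insert b S)"
  unfolding chained_def
proof (intro allI impI)
  fix B assume B: "B \<subseteq> insert b S" "B \<noteq> {}" "B \<noteq> insert b S"
  have ab: "dist b a \<le> \<delta>" using assms(3) by (simp add: dist_commute)
  show "\<exists>x\<in>B. \<exists>y\<in>insert b S - B. dist x y \<le> \<delta>"
  proof (cases "B \<inter> S = {} \<or> B \<inter> S = S")
    case True
    then have "a \<in> B \<and> b \<notin> B \<or> b \<in> B \<and> a \<notin> B" using B assms(2) by auto
    then show ?thesis using assms(2,3) ab by blast
  next
    case False
    then obtain x y where "x \<in> B \<inter> S" "y \<in> S - B \<inter> S" "dist x y \<le> \<delta>"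
      using assms(1) unfolding chained_def by (metis inf_le2)
    then show ?thesis by blast
  qed
qed

lemma chained_append_segment:
  fixes x y :: "'a::real_normed_vector"
  assumes "convex \<Theta>" "x \<in> \<Theta>" "y \<in> \<Theta>" "dist x y \<le> \<epsilon>" "L > 0"
    and S: "finite S" "S \<subseteq> \<Theta>" "chained (\<epsilon> / real L) S" "x \<in> S"
  obtains S' where "finite S'" "S' \<subseteq> \<Theta>" "chained (\<epsilon> / real L) S'" "S \<subseteq> S'" "y \<in> S'"
    "card S' \<le> card S + L"
proof -
  define p where "p i = x + (real i / real L) *\<^sub>R (y - x)" for i
  have p0: "p 0 = x" and pL: "p L = y" using \<open>L > 0\<close> by (auto simp: p_def)
  have p_in: "p i \<in> \<Theta>" if "i \<le> L" for i
  proof -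
    have "p i = (1 - real i / real L) *\<^sub>R x + (real i / real L) *\<^sub>R y"
      by (simp add: p_def algebra_simps)
    moreover have "real i / real L \<le> 1" using that \<open>L > 0\<close> by simp
    ultimately show ?thesis using convexD[OF assms(1-3)] by simp
  qed
  have step: "dist (p i) (p (Suc i)) \<le> \<epsilon> / real L" for i
  proof -
    have "p (Suc i) - p i = (1 / real L) *\<^sub>R (y - x)"
      by (simp add: p_def add_divide_distrib scaleR_left_distrib)
    then have "dist (p i) (p (Suc i)) = norm ((1 / real L) *\<^sub>R (y - x))"
      by (metis dist_commute dist_norm)
    also have "\<dots> = dist x y / real L" by (simp add: dist_norm norm_minus_commute)
    finally show ?thesis using assms(4,5) by (simp add: divide_right_mono)
  qed
  \<comment> \<open>The points \<open>p i\<close> enter one at a time. Some may already lie in the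
    set, so the cardinality is only bounded.\<close>
  have "\<exists>S'. finite S' \<and> S' \<subseteq> \<Theta> \<and> chained (\<epsilon> / real L) S' \<and> S \<subseteq> S' \<and> p i \<in> S' \<and>
      card S' \<le> card S + i" if "i \<le> L" for i
    using that
  proof (induction i)
    case 0
    then show ?case using S p0 by auto
  next
    case (Suc i)
    then obtain S' where S': "finite S'" "S' \<subseteq> \<Theta>" "chained (\<epsilon> / real L) S'" "S \<subseteq> S'" "p i \<in> S'"
      "card S' \<le> card S + i" by auto
    have "chained (\<epsilon> / real L) (insert (p (Suc i)) S')"
      using chained_insert[OF S'(3,5) step] .
    moreover have "card (insert (p (Suc i)) S') \<le> card S + Suc i"
      using S'(1,6) by (simp add: card_insert_if)
    ultimately show ?case using S' p_in[OF Suc.prems]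
      by (intro exI[of _ "insert (p (Suc i)) S'"]) auto
  qed
  from this[of L] show ?thesis using that pL by auto
qed

text \<open>The closed balls of radius \<epsilon> / 2 about \<open>Y\<close> and about
  \<open>X - Y\<close> form two closed sets that cover \<Theta>. Connectedness makes them meet in
  \<Theta>, and the centres of two balls through a common point are at most \<epsilon>
  apart.\<close>

lemma cover_crossing:
  assumes "connected \<Theta>" "finite X" "is_cover \<Theta> (\<epsilon> / 2) X" "Y \<subseteq> X" "Y \<noteq> {}" "Y \<noteq> X" "\<epsilon> \<ge> 0"
  obtains x y where "x \<in> Y" "y \<in> X - Y" "dist x y \<le> \<epsilon>"
proof -
  define A where "A Z = (\<Union>z\<in>Z. cball z (\<epsilon> / 2))" for Z :: "'a set"
  have closed_A: "closed (A Z)" if "Z \<subseteq> X" for Z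
    unfolding A_def using that assms(2) finite_subset by (intro closed_UN) auto
  have X: "X \<subseteq> \<Theta>" using assms(3) by (simp add: is_cover_def)
  have sub: "\<Theta> \<subseteq> A Y \<union> A (X - Y)"
    using assms(3) by (fastforce simp: is_cover_def A_def dist_commute)
  have self: "Z \<subseteq> A Z" for Z using assms(7) by (auto simp: A_def)
  have "A Y \<inter> \<Theta> \<noteq> {}" "A (X - Y) \<inter> \<Theta> \<noteq> {}"
    using self[of Y] self[of "X - Y"] X assms(4-6) by blast+
  then have "A Y \<inter> A (X - Y) \<inter> \<Theta> \<noteq> {}"
    using assms(1) closed_A[OF assms(4)] closed_A[of "X - Y"] sub
    unfolding connected_closed by blast
  then obtain t where "t \<in> A Y" "t \<in> A (X - Y)" by blast
  then obtain x y where "x \<in> Y" "y \<in> X - Y" "dist x t \<le> \<epsilon> / 2" "dist y t \<le> \<epsilon> / 2"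
    unfolding A_def by (metis UN_E mem_cball)
  moreover then have "dist x y \<le> \<epsilon>" using dist_triangle2[of x y t] by simp
  ultimately show ?thesis using that by blast
qed

text \<open>A spanning tree is grown: \<open>Y\<close> holds the cover points attached so far, and
  each crossing edge attaches one more at the price of at most \<open>L\<close> new points.\<close>

lemma chained_superset_of_cover:
  assumes "convex \<Theta>" "finite X" "is_cover \<Theta> (\<epsilon> / 2) X" "X \<noteq> {}" "\<epsilon> \<ge> 0" "L > 0"
  obtains S where "finite S" "S \<subseteq> \<Theta>" "X \<subseteq> S" "chained (\<epsilon> / real L) S"
    "card S \<le> L * (card X - 1) + 1"
proof -
  have X: "X \<subseteq> \<Theta>" using assms(3) by (simp add: is_cover_def)
  have "\<exists>Y S. Y \<subseteq> X \<and> card Y = Suc n \<and> Y \<subseteq> S \<and> finite S \<and> S \<subseteq> \<Theta> \<and> chained (\<epsilon> / real L) S \<and>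
      card S \<le> L * n + 1" if "n < card X" for n
    using that
  proof (induction n)
    case 0
    obtain x where "x \<in> X" using assms(4) by auto
    then show ?case using X by (intro exI[of _ "{x}"]) (auto simp: chained_singleton)
  next
    case (Suc n)
    then obtain Y S where Y: "Y \<subseteq> X" "card Y = Suc n" "Y \<subseteq> S" "finite S" "S \<subseteq> \<Theta>"
      "chained (\<epsilon> / real L) S" "card S \<le> L * n + 1" by auto
    have "Y \<noteq> {}" "Y \<noteq> X" using Y(2) Suc.prems by auto
    then obtain x y where xy: "x \<in> Y" "y \<in> X - Y" "dist x y \<le> \<epsilon>"
      using cover_crossing[OF convex_connected[OF assms(1)] assms(2,3) Y(1) _ _ assms(5)] by blast
    then obtain S' where S': "finite S'" "S' \<subseteq> \<Theta>" "chained (\<epsilon> / real L) S'" "S \<subseteq> S'" "y \<in> S'"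
        "card S' \<le> card S + L"
      using chained_append_segment[OF assms(1) _ _ xy(3) assms(6) Y(4-6)] X Y(1,3) by blast
    have "card (insert y Y) = Suc (Suc n)"
      using xy(2) Y(2) finite_subset[OF Y(1) assms(2)] by simp
    then show ?case using S' Y xy
      by (intro exI[of _ "insert y Y"] exI[of _ S']) (auto simp: algebra_simps)
  qed
  moreover have "card X - 1 < card X" using assms(2,4) by (simp add: card_gt_0_iff)
  ultimately obtain Y S where "Y \<subseteq> X" "card Y = Suc (card X - 1)" "Y \<subseteq> S" "finite S" "S \<subseteq> \<Theta>"
      "chained (\<epsilon> / real L) S" "card S \<le> L * (card X - 1) + 1"
    by blast
  moreover then have "Y = X"
    using assms(2,4) by (intro card_subset_eq) (auto simp: card_gt_0_iff)
  ultimately show ?thesis using that by blast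
qed

text \<open>Repeating a point pads the list to the exact committee size, while
  \<open>chained\<close> sees only the set of locations.\<close>

lemma obtain_list_of_length:
  assumes "finite S" "S \<noteq> {}" "card S \<le> n"
  obtains xs where "set xs = S" "length xs = n"
proof -
  obtain ys where ys: "set ys = S" "distinct ys" using finite_distinct_list[OF assms(1)] by blast
  then have "length ys \<le> n" using assms(3) distinct_card by fastforce
  moreover obtain x where "x \<in> S" using assms(2) by blast
  ultimately have "set (ys @ replicate (n - length ys) x) = S"
    "length (ys @ replicate (n - length ys) x) = n"
    using ys(1) by (auto simp: set_replicate_conv_if)
  then show ?thesis by (rule that)
qed

section \<open>Rankings\<close>

lemma is_top_ranking_distinct:
  assumes "is_top_ranking m k c q e r"
  shows "distinct r" "length r = k" "set r \<subseteq> {1..m}"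
proof -
  have r: "length r = k" "r ! h \<in> {1..m} - set (take h r)" if "h < k" for h
    using assms that by (auto simp: is_top_ranking_def is_arg_max_def)
  show len: "length r = k" using assms by (simp add: is_top_ranking_def)
  show "set r \<subseteq> {1..m}" using r(2) len by (auto simp: in_set_conv_nth)
  have "r ! i \<noteq> r ! j" if "i < j" "j < k" for i j
  proof -
    have "r ! i \<in> set (take j r)" using that len by (auto simp: in_set_conv_nth intro!: exI[of _ i])
    then show ?thesis using r(2)[of j] that by auto
  qed
  then show "distinct r" unfolding distinct_conv_nth len by (metis nat_neq_iff)
qed

lemma is_top_ranking_imp_ge:
  assumes "is_top_ranking m k c q e r" "ranked_above r a b" "b \<in> {1..m}"
  shows "q a - dist e (c a) \<ge> q b - dist e (c b)"
proof -
  note r = is_top_ranking_distinct[OF assms(1)]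
  from assms(2) obtain h where h: "h < k" "r ! h = a"
    "(\<exists>h'<k. h < h' \<and> r ! h' = b) \<or> b \<notin> set r" using r(2) by (auto simp: ranked_above_def)
  \<comment> \<open>So \<open>b\<close> was still available when \<open>a\<close> was picked at
    position \<open>h\<close>.\<close>
  have "b \<notin> set (take h r)"
  proof
    assume "b \<in> set (take h r)"
    then obtain i where "i < h" "r ! i = b" by (auto simp: in_set_conv_nth)
    then show False using h r(1,2) by (auto simp: distinct_conv_nth)
  qed
  then show ?thesis
    using assms(1,3) h(1,2) by (force simp: is_top_ranking_def is_arg_max_def not_less)
qed

lemma consistent_true_quality:
  assumes "\<forall>i<length E. is_top_ranking m k c q (E ! i) (R i)"
  shows "consistent m c E R q"
  using assms is_top_ranking_imp_ge unfolding consistent_def by blast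

lemma ranked_above_total:
  assumes "a \<in> set r" "a \<noteq> b"
  shows "ranked_above r a b \<or> ranked_above r b a"
  using assms by (auto simp: ranked_above_def in_set_conv_nth) (metis nat_neq_iff)

lemma ranked_above_hd:
  assumes "r \<noteq> []" "distinct r" "b \<noteq> hd r"
  shows "ranked_above r (hd r) b" "\<not> ranked_above r b (hd r)"
  using assms
  by (cases r; auto simp: ranked_above_def in_set_conv_nth nth_Cons split: nat.splits; force)+

lemma ranked_above_notin:
  assumes "a \<in> set r" "b \<notin> set r"
  shows "ranked_above r a b"
  using assms by (auto simp: ranked_above_def in_set_conv_nth)

section \<open>Differences that are known up to an error\<close>

definition known_within :: "(nat \<Rightarrow> real) set \<Rightarrow> real \<Rightarrow> nat \<Rightarrow> nat \<Rightarrow> bool" where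
  "known_within Q r a b \<longleftrightarrow> (\<exists>\<mu>. \<forall>q\<in>Q. \<bar>q a - q b - \<mu>\<bar> \<le> r)"

lemma known_within_refl: "r \<ge> 0 \<Longrightarrow> known_within Q r a a"
  unfolding known_within_def by (intro exI[of _ 0]) auto

lemma known_within_sym: "known_within Q r a b \<Longrightarrow> known_within Q r b a"
  unfolding known_within_def
proof (elim exE)
  fix \<mu> assume "\<forall>q\<in>Q. \<bar>q a - q b - \<mu>\<bar> \<le> r"
  then show "\<exists>\<mu>. \<forall>q\<in>Q. \<bar>q b - q a - \<mu>\<bar> \<le> r" by (intro exI[of _ "-\<mu>"]) (force simp: abs_le_iff)
qed

lemma known_within_trans:
  "known_within Q r a b \<Longrightarrow> known_within Q s b c \<Longrightarrow> known_within Q (r + s) a c"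
  unfolding known_within_def
proof (elim exE)
  fix \<mu> \<nu> assume 1: "\<forall>q\<in>Q. \<bar>q a - q b - \<mu>\<bar> \<le> r" and 2: "\<forall>q\<in>Q. \<bar>q b - q c - \<nu>\<bar> \<le> s"
  have "\<bar>q a - q c - (\<mu> + \<nu>)\<bar> \<le> r + s" if "q \<in> Q" for q
    using bspec[OF 1 that] bspec[OF 2 that] by linarith
  then show "\<exists>\<mu>. \<forall>q\<in>Q. \<bar>q a - q c - \<mu>\<bar> \<le> r + s" by blast
qed

text \<open>The centres for all pairs are differences of one function \<mu>, so maximizing \<mu>
  gives a candidate that is good against all others at once. Only differences occur because reports
  fix qualities at best up to a common shift.\<close>

definition potential_within :: "(nat \<Rightarrow> real) set \<Rightarrow> real \<Rightarrow> nat set \<Rightarrow> bool" where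
  "potential_within Q r T \<longleftrightarrow>
     (\<exists>\<mu>. \<forall>a\<in>T. \<forall>b\<in>T. \<forall>q\<in>Q. \<bar>(q a - q b) - (\<mu> a - \<mu> b)\<bar> \<le> r)"

text \<open>Pairs inside \<open>Z\<close> keep the error \<open>r\<close>, and pairs with
  \<open>a\<close> are routed through \<open>z\<close>, so an insertion costs \<open>s\<close>
  once.\<close>

lemma potential_within_insert:
  assumes "potential_within Q r Z" "z \<in> Z" "known_within Q s a z" "r \<ge> 0" "s \<ge> 0"
  shows "potential_within Q (r + s) (insert a Z)"
proof (cases "a \<in> Z")
  case True
  from assms(1) obtain \<mu> where
    "\<And>x y q. x \<in> Z \<Longrightarrow> y \<in> Z \<Longrightarrow> q \<in> Q \<Longrightarrow> \<bar>(q x - q y) - (\<mu> x - \<mu> y)\<bar> \<le> r"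
    unfolding potential_within_def by blast
  then have "\<bar>(q x - q y) - (\<mu> x - \<mu> y)\<bar> \<le> r + s" if "x \<in> Z" "y \<in> Z" "q \<in> Q" for x y q
    using that assms(5) by fastforce
  then show ?thesis unfolding potential_within_def using True by (metis insert_absorb)
next
  case False
  from assms(1) obtain \<mu> where
    \<mu>: "\<And>x y q. x \<in> Z \<Longrightarrow> y \<in> Z \<Longrightarrow> q \<in> Q \<Longrightarrow> \<bar>(q x - q y) - (\<mu> x - \<mu> y)\<bar> \<le> r"
    unfolding potential_within_def by blast
  from assms(3) obtain \<nu> where \<nu>: "\<And>q. q \<in> Q \<Longrightarrow> \<bar>q a - q z - \<nu>\<bar> \<le> s"
    unfolding known_within_def by blast
  define \<mu>' where "\<mu>' = \<mu>(a := \<mu> z + \<nu>)"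
  have \<mu>'a: "\<mu>' a = \<mu> z + \<nu>" and \<mu>'Z: "\<And>x. x \<in> Z \<Longrightarrow> \<mu>' x = \<mu> x"
    using False by (auto simp: \<mu>'_def)
  have "\<bar>(q x - q y) - (\<mu>' x - \<mu>' y)\<bar> \<le> r + s"
    if "x \<in> insert a Z" "y \<in> insert a Z" "q \<in> Q" for x y q
  proof (cases "x = a"; cases "y = a")
    assume "x = a" "y = a"
    then show ?thesis using assms(4,5) by simp
  next
    assume "x = a" "y \<noteq> a"
    then show ?thesis using \<mu>[of z y q] \<nu>[of q] \<mu>'a \<mu>'Z[of y] that assms(2) by (smt (verit) insertE)
  next
    assume "x \<noteq> a" "y = a"
    then show ?thesis using \<mu>[of x z q] \<nu>[of q] \<mu>'a \<mu>'Z[of x] that assms(2) by (smt (verit) insertE)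
  next
    assume "x \<noteq> a" "y \<noteq> a"
    then show ?thesis using \<mu>[of x y q] \<mu>'Z[of x] \<mu>'Z[of y] that assms(5) by (smt (verit) insertE)
  qed
  then show ?thesis unfolding potential_within_def by blast
qed

text \<open>Both ends of a pair are moved into \<open>Z\<close>, which costs \<open>s\<close> twice,
  however large \<open>T\<close> is.\<close>

lemma potential_within_extend:
  assumes "potential_within Q r Z" "\<And>a. a \<in> T \<Longrightarrow> \<exists>z\<in>Z. known_within Q s a z"
  shows "potential_within Q (r + 2 * s) T"
proof -
  from assms(1) obtain \<mu> where
    \<mu>: "\<And>x y q. x \<in> Z \<Longrightarrow> y \<in> Z \<Longrightarrow> q \<in> Q \<Longrightarrow> \<bar>(q x - q y) - (\<mu> x - \<mu> y)\<bar> \<le> r"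
    unfolding potential_within_def by blast
  from assms(2) obtain z \<nu> where z: "\<And>a. a \<in> T \<Longrightarrow> z a \<in> Z"
    and \<nu>: "\<And>a q. a \<in> T \<Longrightarrow> q \<in> Q \<Longrightarrow> \<bar>q a - q (z a) - \<nu> a\<bar> \<le> s"
    unfolding known_within_def by metis
  have "\<bar>(q a - q b) - ((\<mu> (z a) + \<nu> a) - (\<mu> (z b) + \<nu> b))\<bar> \<le> r + 2 * s"
    if "a \<in> T" "b \<in> T" "q \<in> Q" for a b q
    using \<mu>[OF z[OF that(1)] z[OF that(2)] that(3)] \<nu>[OF that(1,3)] \<nu>[OF that(2,3)] by linarith
  then show ?thesis unfolding potential_within_def
    by (intro exI[of _ "\<lambda>a. \<mu> (z a) + \<nu> a"]) blast
qed

section \<open>Reports of a chained committee\<close>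

text \<open>All bounds here hold for every consistent vector; the true qualities enter later,
  through \<open>consistent_true_quality\<close>.\<close>

locale chained_reports =
  fixes m k :: nat and c :: "nat \<Rightarrow> 'a::real_normed_vector" and E :: "'a list"
    and R :: "nat \<Rightarrow> nat list" and \<delta> :: real
  assumes k: "1 \<le> k" and \<delta>: "\<delta> \<ge> 0" and E: "E \<noteq> []" and chained: "chained \<delta> (set E)"
    and R: "\<And>i. i < length E \<Longrightarrow> distinct (R i)" "\<And>i. i < length E \<Longrightarrow> length (R i) = k"
      "\<And>i. i < length E \<Longrightarrow> set (R i) \<subseteq> {1..m}"
begin

abbreviation "Q \<equiv> {q'. consistent m c E R q'}"

definition "tops = (\<lambda>i. hd (R i)) ` {..<length E}"

text \<open>Links do not compose: two in a row give only the error 2 \<delta>.\<close>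

definition "linked a b \<longleftrightarrow> known_within Q \<delta> a b"

definition "nbhd a = {b \<in> {1..m}. linked a b}"

text \<open>Experts may share a location, so the locations of a proper subset \<open>B\<close> may
  exhaust the committee. Then some index outside \<open>B\<close> has the same location as one in
  \<open>B\<close>, at distance 0.\<close>

lemma chained_indices:
  assumes "B \<subseteq> {..<length E}" "B \<noteq> {}" "B \<noteq> {..<length E}"
  obtains i j where "i \<in> B" "j \<in> {..<length E} - B" "dist (E ! i) (E ! j) \<le> \<delta>"
proof (cases "(!) E ` B = set E")
  case True
  obtain j where j: "j \<in> {..<length E} - B" using assms by auto
  then have "E ! j \<in> (!) E ` B" using True by auto
  then obtain i where "i \<in> B" "E ! j = E ! i" by auto
  then show ?thesis using that[of i j] j \<delta> by auto
next
  case False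
  have "(!) E ` B \<subseteq> set E" using assms(1) by auto
  then obtain x y where "x \<in> (!) E ` B" "y \<in> set E - (!) E ` B" "dist x y \<le> \<delta>"
    using chained False assms(2) unfolding chained_def by (metis image_is_empty)
  then show ?thesis using that by (auto simp: in_set_conv_nth)
qed

lemma R_nonempty: "i < length E \<Longrightarrow> R i \<noteq> []"
  using R(2)[of i] k by auto

lemma hd_R_in: "i < length E \<Longrightarrow> hd (R i) \<in> {1..m}"
  using R(3)[of i] R_nonempty[of i] hd_in_set by blast

lemma tops_subset: "tops \<subseteq> {1..m}"
  using hd_R_in by (auto simp: tops_def)

lemma finite_tops: "finite tops" and tops_nonempty: "tops \<noteq> {}"
  using E by (auto simp: tops_def)

section \<open>Links revealed by neighbouring experts\<close>

lemma linked_sym: "linked a b \<Longrightarrow> linked b a"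
  unfolding linked_def by (rule known_within_sym)

lemma linked_refl: "linked a a"
  unfolding linked_def using \<delta> by (rule known_within_refl)

text \<open>Expert \<open>i\<close> bounds \<open>q a - q b\<close> below by \<alpha> and expert
  \<open>j\<close> bounds it above by \<beta>. Moving between the two experts changes each distance
  by at most \<delta>, so the interval has length at most 2 \<delta> and its midpoint errs by at
  most \<delta>.\<close>

lemma linked_if_swapped:
  assumes "i < length E" "j < length E" "dist (E ! i) (E ! j) \<le> \<delta>" "a \<in> {1..m}" "b \<in> {1..m}"
    "ranked_above (R i) a b" "ranked_above (R j) b a"
  shows "linked a b"
proof -
  define \<alpha> where "\<alpha> = dist (E ! i) (c a) - dist (E ! i) (c b)"
  define \<beta> where "\<beta> = dist (E ! j) (c a) - dist (E ! j) (c b)"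
  have width: "\<beta> - \<alpha> \<le> 2 * \<delta>"
    using assms(3) dist_triangle[of "E ! j" "c a" "E ! i"] dist_triangle[of "E ! i" "c b" "E ! j"]
    by (simp add: \<alpha>_def \<beta>_def dist_commute)
  have "\<bar>q a - q b - (\<alpha> + \<beta>) / 2\<bar> \<le> \<delta>" if "q \<in> Q" for q
  proof -
    have "q a - q b \<ge> \<alpha>" "q a - q b \<le> \<beta>"
      using that assms unfolding consistent_def \<alpha>_def \<beta>_def by fastforce+
    then show ?thesis using width by (simp add: abs_le_iff field_simps)
  qed
  then show ?thesis unfolding linked_def known_within_def by blast
qed

text \<open>If the two tops differ, each expert ranks her own above the other's, so their order is
  swapped.\<close>

lemma linked_adjacent_tops:
  assumes "i < length E" "j < length E" "dist (E ! i) (E ! j) \<le> \<delta>"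
  shows "linked (hd (R i)) (hd (R j))"
proof (cases "hd (R i) = hd (R j)")
  case False
  then show ?thesis
    using assms hd_R_in R R_nonempty by (intro linked_if_swapped[of i j] ranked_above_hd) auto
qed (simp add: linked_refl)

section \<open>Paths of experts that list a given candidate\<close>

inductive reach :: "nat \<Rightarrow> nat \<Rightarrow> nat \<Rightarrow> bool" for a i where
  start: "reach a i i"
| step: "reach a i j \<Longrightarrow> l < length E \<Longrightarrow> a \<in> set (R l) \<Longrightarrow> dist (E ! j) (E ! l) \<le> \<delta> \<Longrightarrow> reach a i l"

lemma reach_list:
  assumes "i < length E" "reach (hd (R i)) i j"
  shows "j < length E" "hd (R i) \<in> set (R j)"
  using assms(2) by (induction) (use assms(1) R_nonempty in auto)

text \<open>Every list on the path contains the top candidate of \<open>i\<close> and hence compares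
  it with \<open>b\<close>. If the order ever changes along the path, it does so between two
  neighbours, which gives a link.\<close>

lemma above_or_linked:
  assumes "i < length E" "reach (hd (R i)) i j" "b \<in> {1..m}" "b \<noteq> hd (R i)"
  shows "ranked_above (R j) (hd (R i)) b \<or> linked (hd (R i)) b"
  using assms(2)
proof (induction)
  case start
  then show ?case using ranked_above_hd(1) assms(1,4) R R_nonempty by blast
next
  case (step j l)
  then show ?case
    using ranked_above_total[of "hd (R i)" "R l" b] reach_list[OF assms(1)] assms hd_R_in
      linked_if_swapped[of j l "hd (R i)" b] by blast
qed

lemma top_dichotomy:
  assumes "t \<in> tops"
  shows "tops \<subseteq> nbhd t \<or> k + 1 \<le> card (nbhd t)"
proof -
  from assms obtain i where i: "i < length E" "t = hd (R i)" by (auto simp: tops_def)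
  define C where "C = {j. reach t i j}"
  have C: "C \<subseteq> {..<length E}" using reach_list i by (auto simp: C_def)
  have t: "t \<in> {1..m}" using assms tops_subset by blast
  show ?thesis
  proof (cases "C = {..<length E}")
    \<comment> \<open>Every expert is reached, and expert \<open>j\<close> does not rank
      \<open>t\<close> above her own top, so \<open>t\<close> is linked to that top.\<close>
    case True
    have "linked t (hd (R j))" if j: "j < length E" for j
    proof (cases "hd (R j) = t")
      case False
      have "reach t i j" using True j by (auto simp: C_def)
      then show ?thesis
        using above_or_linked[of i j "hd (R j)"] ranked_above_hd(2)[of "R j" t] False i j
          R(1) R_nonempty hd_R_in by metis
    qed (simp add: linked_refl)
    then have "tops \<subseteq> nbhd t" using hd_R_in by (auto simp: tops_def nbhd_def)
    then show ?thesis ..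
  next
    \<comment> \<open>A step leaves \<open>C\<close> towards an expert \<open>l\<close> that does
      not list \<open>t\<close>. She ranks all \<open>k\<close> members of her list above
      \<open>t\<close>, so each is linked to \<open>t\<close>; \<open>t\<close> itself accounts for
      the \<open>+ 1\<close>.\<close>
    case False
    have "i \<in> C" by (auto simp: C_def reach.start)
    then obtain j l where jl: "j \<in> C" "l \<in> {..<length E} - C" "dist (E ! j) (E ! l) \<le> \<delta>"
      using chained_indices[OF C _ False] by blast
    have tl: "t \<notin> set (R l)" using reach.step jl by (auto simp: C_def)
    have "linked t b" if b: "b \<in> set (R l)" for b
    proof -
      have "b \<in> {1..m}" using R(3)[of l] b jl by auto
      moreover have "b \<noteq> t" using b tl by blast
      ultimately show ?thesis
        using above_or_linked[of i j b] linked_if_swapped[of j l t b] i jl C t b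
          ranked_above_notin[OF b tl] by (auto simp: C_def)
    qed
    then have "insert t (set (R l)) \<subseteq> nbhd t"
      using R(3)[of l] jl t linked_refl by (auto simp: nbhd_def)
    moreover have "card (insert t (set (R l))) = k + 1"
      using tl R(1,2)[of l] jl distinct_card[of "R l"] by simp
    moreover have "finite (nbhd t)" by (simp add: nbhd_def)
    ultimately show ?thesis by (metis card_mono)
  qed
qed

section \<open>Estimating the qualities of all top candidates\<close>

lemma potential_tops_if_universal:
  assumes "t \<in> tops" "tops \<subseteq> nbhd t"
  shows "potential_within Q (2 * \<delta>) tops"
proof -
  have "potential_within Q 0 {t}" by (auto simp: potential_within_def)
  then have "potential_within Q (0 + 2 * \<delta>) tops"
    by (rule potential_within_extend) (use assms(2) linked_sym in \<open>auto simp: nbhd_def linked_def\<close>)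
  then show ?thesis by simp
qed

lemma potential_tops_if_large_nbhds:
  assumes large: "\<And>t. t \<in> tops \<Longrightarrow> k + 1 \<le> card (nbhd t)"
  obtains s where "1 \<le> s" "s * (k + 1) \<le> m" "potential_within Q ((3 * real s + 1) * \<delta>) tops"
proof -
  \<comment> \<open>The first member is free and each later one costs 3 \<delta>. The error bound is
    part of \<open>P\<close>, so maximality is only among families that satisfy it, and an extension
    has to preserve it.\<close>
  define P where "P Z \<longleftrightarrow> Z \<noteq> {} \<and> Z \<subseteq> tops \<and> disjoint_family_on nbhd Z \<and>
    potential_within Q (3 * (real (card Z) - 1) * \<delta>) Z" for Z
  obtain t where t: "t \<in> tops" using tops_nonempty by blast
  have "P {t}" using t by (auto simp: P_def potential_within_def disjoint_family_on_def)
  moreover have "\<forall>Z. P Z \<longrightarrow> card Z < Suc (card tops)"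
    using finite_tops by (auto simp: P_def card_mono less_Suc_eq_le)
  ultimately obtain Z where PZ: "P Z" and maxZ: "\<And>Z'. P Z' \<Longrightarrow> card Z' \<le> card Z"
    using ex_has_greatest_nat[of P "{t}" card "Suc (card tops)"] by blast
  have Z: "Z \<noteq> {}" "Z \<subseteq> tops" "disjoint_family_on nbhd Z"
    "potential_within Q (3 * (real (card Z) - 1) * \<delta>) Z" using PZ by (auto simp: P_def)
  have finZ: "finite Z" using Z(2) finite_tops finite_subset by blast
  then have cardZ: "1 \<le> card Z" using Z(1) by (simp add: Suc_leI card_gt_0_iff)
  have meets: "known_within Q (2 * \<delta>) a z" if "nbhd a \<inter> nbhd z \<noteq> {}" for a z
  proof -
    obtain b where "linked a b" "linked z b" using \<open>nbhd a \<inter> nbhd z \<noteq> {}\<close> by (auto simp: nbhd_def)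
    then show ?thesis using known_within_trans[of Q \<delta> a b \<delta> z] linked_sym[of z b]
      by (auto simp: linked_def)
  qed
  \<comment> \<open>If \<open>B\<close> missed an expert, an edge leaving \<open>B\<close> would
    lead to a top candidate \<open>a\<close> whose neighbourhood avoids the whole family but which
    is linked to a top candidate near it.\<close>
  define B where "B = {i. i < length E \<and> (\<exists>z\<in>Z. nbhd (hd (R i)) \<inter> nbhd z \<noteq> {})}"
  have "B = {..<length E}"
  proof (rule ccontr)
    assume "B \<noteq> {..<length E}"
    moreover have "B \<subseteq> {..<length E}" by (auto simp: B_def)
    moreover have "B \<noteq> {}"
    proof -
      obtain z where z: "z \<in> Z" using Z(1) by blast
      then obtain i where "i < length E" "z = hd (R i)" using Z(2) by (auto simp: tops_def)
      moreover have "nbhd z \<noteq> {}" using large z Z(2) by fastforce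
      ultimately have "i \<in> B" using z by (auto simp: B_def)
      then show ?thesis by blast
    qed
    ultimately obtain i j where ij: "i \<in> B" "j \<in> {..<length E} - B" "dist (E ! i) (E ! j) \<le> \<delta>"
      using chained_indices by metis
    define a where "a = hd (R j)"
    have a: "a \<in> tops" using ij by (auto simp: a_def tops_def)
    have a_disj: "nbhd a \<inter> nbhd z = {}" if "z \<in> Z" for z using ij(2) that by (auto simp: B_def a_def)
    moreover have "nbhd a \<noteq> {}" using large[OF a] by auto
    ultimately have aZ: "a \<notin> Z" by blast
    obtain z where z: "z \<in> Z" "nbhd (hd (R i)) \<inter> nbhd z \<noteq> {}" using ij(1) by (auto simp: B_def)
    have "linked a (hd (R i))"
      using linked_adjacent_tops[of j i] ij by (auto simp: a_def B_def dist_commute)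
    \<comment> \<open>One \<delta> leads from \<open>a\<close> to the adjacent top candidate, and 2
      \<delta> from there through a common neighbour to \<open>z\<close>.\<close>
    then have "known_within Q (3 * \<delta>) a z"
      using known_within_trans[of Q \<delta> a "hd (R i)" "2 * \<delta>" z] meets[OF z(2)] by (simp add: linked_def)
    then have "potential_within Q (3 * (real (card Z) - 1) * \<delta> + 3 * \<delta>) (insert a Z)"
      using potential_within_insert[OF Z(4) z(1)] cardZ \<delta> by simp
    then have "potential_within Q (3 * (real (card (insert a Z)) - 1) * \<delta>) (insert a Z)"
      using finZ aZ by (simp add: algebra_simps)
    moreover have "disjoint_family_on nbhd (insert a Z)"
      using Z(3) a_disj aZ by (auto simp: disjoint_family_on_insert)
    ultimately have "P (insert a Z)" using Z a by (auto simp: P_def)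
    then show False using maxZ[of "insert a Z"] finZ aZ by simp
  qed
  then have "\<exists>z\<in>Z. known_within Q (2 * \<delta>) a z" if "a \<in> tops" for a
    using that meets unfolding B_def tops_def by blast
  \<comment> \<open>Moving both ends into \<open>Z\<close> adds 4 \<delta>, and 3 (s - 1) + 4 = 3 s
    + 1.\<close>
  from potential_within_extend[OF Z(4) this]
  have "potential_within Q ((3 * real (card Z) + 1) * \<delta>) tops" by (simp add: algebra_simps)
  moreover have "card Z * (k + 1) \<le> m"
  proof -
    have "card Z * (k + 1) = (\<Sum>z\<in>Z. k + 1)" by simp
    also have "\<dots> \<le> (\<Sum>z\<in>Z. card (nbhd z))" using large Z(2) by (intro sum_mono) blast
    also have "\<dots> = card (\<Union>z\<in>Z. nbhd z)"
      using finZ Z(3) by (intro card_UN_disjoint[symmetric])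
        (auto simp: disjoint_family_on_def nbhd_def)
    also have "\<dots> \<le> card {1..m}" by (intro card_mono) (auto simp: nbhd_def)
    finally show ?thesis by simp
  qed
  ultimately show ?thesis using that cardZ by blast
qed

lemma exists_low_regret_candidate:
  assumes pot: "potential_within Q (\<epsilon> / 2) tops"
    and near: "\<And>h. h \<in> {1..m} \<Longrightarrow> \<exists>x\<in>set E. dist (c h) x \<le> \<epsilon> / 2"
  obtains g where "g \<in> {1..m}" "worst_case_regret m c E R g \<le> ereal \<epsilon>"
proof -
  from pot obtain \<mu> where
    \<mu>: "\<And>a b q. a \<in> tops \<Longrightarrow> b \<in> tops \<Longrightarrow> q \<in> Q \<Longrightarrow> \<bar>(q a - q b) - (\<mu> a - \<mu> b)\<bar> \<le> \<epsilon> / 2"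
    unfolding potential_within_def by blast
  \<comment> \<open>A top candidate that is best for the estimate. Any \<open>h\<close> loses at
    most \<epsilon> / 2 to the top candidate of a nearby expert, and that one at most \<epsilon> / 2
    to \<open>g\<close>.\<close>
  obtain g where "g \<in> tops" "Max (\<mu> ` tops) = \<mu> g"
    using obtains_MAX[OF finite_tops tops_nonempty, of \<mu>] .
  then have g: "g \<in> tops" "\<And>a. a \<in> tops \<Longrightarrow> \<mu> a \<le> \<mu> g"
    using finite_tops by (simp, metis Max_ge finite_imageI imageI)
  have "q h - q g \<le> \<epsilon>" if h: "h \<in> {1..m}" and q: "q \<in> Q" for q h
  proof -
    obtain i where i: "i < length E" "dist (c h) (E ! i) \<le> \<epsilon> / 2"
      using near[OF h] by (auto simp: in_set_conv_nth)
    define t where "t = hd (R i)"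
    have t: "t \<in> tops" using i by (auto simp: t_def tops_def)
    have "q h - q t \<le> \<epsilon> / 2"
    proof (cases "h = t")
      case True
      then show ?thesis using i(2) order_trans[OF zero_le_dist] by fastforce
    next
      case False
      then have "ranked_above (R i) t h" using ranked_above_hd(1) i R R_nonempty t_def by blast
      then have "q t - dist (E ! i) (c t) \<ge> q h - dist (E ! i) (c h)"
        using q i(1) h t tops_subset unfolding consistent_def by blast
      then show ?thesis using i(2) zero_le_dist[of "E ! i" "c t"] dist_commute[of "c h" "E ! i"]
        by linarith
    qed
    moreover have "q t - q g \<le> \<epsilon> / 2" using \<mu>[OF t g(1) q] g(2)[OF t] by linarith
    ultimately show ?thesis by simp
  qed
  then have "worst_case_regret m c E R g \<le> ereal \<epsilon>"
    unfolding worst_case_regret_def by (intro SUP_least) auto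
  then show ?thesis using that g(1) tops_subset by blast
qed

lemma potential_tops:
  assumes "k \<le> m" "2 \<le> m"
    and \<delta>_small: "\<And>\<rho>::nat. \<rho> * k \<le> 4 * (m - 1) \<Longrightarrow> real \<rho> * \<delta> \<le> \<epsilon> / 2"
  shows "potential_within Q (\<epsilon> / 2) tops"
proof -
  have mono: "potential_within Q (\<epsilon> / 2) tops" if "potential_within Q r tops" "r \<le> \<epsilon> / 2" for r
    using that unfolding potential_within_def by (meson order_trans)
  show ?thesis
  proof (cases "\<exists>t\<in>tops. tops \<subseteq> nbhd t")
    case True
    then have "potential_within Q (2 * \<delta>) tops" using potential_tops_if_universal by blast
    \<comment> \<open>Here 2 k \<le> 4 (m - 1), because k \<le> m \<le> 2 (m - 1).\<close>
    then show ?thesis using mono \<delta>_small[of 2] assms(1,2) by force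
  next
    case False
    then obtain s where s: "1 \<le> s" "s * (k + 1) \<le> m"
      "potential_within Q ((3 * real s + 1) * \<delta>) tops"
      using potential_tops_if_large_nbhds top_dichotomy by metis
    from s(1) obtain u where u: "s = Suc u" by (cases s) auto
    \<comment> \<open>Since s \<ge> 1, (3 s + 1) k \<le> 4 s k \<le> 4 (m - s) \<le> 4 (m -
      1).\<close>
    have "(3 * s + 1) * k \<le> 4 * (m - 1)" using s(2) by (simp add: u algebra_simps)
    from \<delta>_small[OF this] show ?thesis using mono[OF s(3)] by (simp add: algebra_simps)
  qed
qed

end

section \<open>The committee\<close>

text \<open>The infimum over no covers would be \<infinity>, so a finite value forces a cover to
  exist; as \<open>enat\<close> is well-ordered, the infimum is then attained.\<close>

lemma covering_number_attained:
  assumes "covering_number \<Theta> \<delta> = enat N"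
  obtains X where "finite X" "is_cover \<Theta> \<delta> X" "card X = N"
proof -
  let ?A = "(\<lambda>X. enat (card X)) ` {X. finite X \<and> is_cover \<Theta> \<delta> X}"
  have Inf_A: "Inf ?A = enat N" using assms by (simp add: covering_number_def)
  have "?A \<noteq> {}"
  proof
    assume "?A = {}"
    then show False using Inf_A by (simp only: Inf_enat_def) simp
  qed
  then obtain a where "a \<in> ?A" by blast
  then have "Inf ?A \<in> ?A" by (rule wellorder_InfI)
  then have "enat N \<in> ?A" unfolding Inf_A .
  then show ?thesis using that by auto
qed

lemma regret_single_candidate:
  assumes "minimal_regret_candidate 1 c E R g"
  shows "regret 1 q g = 0"
  using assms by (auto simp: minimal_regret_candidate_def is_arg_min_def regret_def)

text \<open>The vector \<open>q\<close> is one of those in the supremum for \<open>g\<close>, which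
  is no larger than that for \<open>g'\<close>. The supremum omits \<open>h = g\<close>, where
  \<epsilon> \<ge> 0 gives the bound.\<close>

lemma regret_le_worst_case:
  assumes "minimal_regret_candidate m c E R g" "consistent m c E R q"
    "g' \<in> {1..m}" "worst_case_regret m c E R g' \<le> ereal \<epsilon>" "\<epsilon> \<ge> 0"
  shows "regret m q g \<le> \<epsilon>"
proof -
  have g: "g \<in> {1..m}" "worst_case_regret m c E R g \<le> worst_case_regret m c E R g'"
    using assms(1,3) by (auto simp: minimal_regret_candidate_def is_arg_min_def not_less)
  have "q h \<le> q g + \<epsilon>" if "h \<in> {1..m}" for h
  proof (cases "h = g")
    case False
    have "ereal (q h - q g) \<le> worst_case_regret m c E R g"
      unfolding worst_case_regret_def
      using that False assms(2) by (intro SUP_upper2[of h] SUP_upper2[of q]) auto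
    also have "\<dots> \<le> ereal \<epsilon>" using g(2) assms(4) by order
    finally show ?thesis by simp
  qed (use assms(5) in simp)
  then have "Max (q ` {1..m}) \<le> q g + \<epsilon>" using g(1) by (subst Max_le_iff) auto
  then show ?thesis by (simp add: regret_def)
qed

lemma chained_committee_regret:
  fixes E :: "'a::real_normed_vector list"
  assumes "\<epsilon> > 0" "1 \<le> k" "k \<le> m" "2 \<le> m" "E \<noteq> []"
    and chained: "chained (\<epsilon> / real (8 * (m - 1) div k)) (set E)"
    and near: "\<And>h. h \<in> {1..m} \<Longrightarrow> \<exists>x\<in>set E. dist (c h) x \<le> \<epsilon> / 2"
    and reports: "\<forall>i<length E. is_top_ranking m k c q (E ! i) (R i)"
    and g: "minimal_regret_candidate m c E R g"
  shows "regret m q g \<le> \<epsilon>"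
proof -
  define L where "L = 8 * (m - 1) div k"
  interpret chained_reports m k c E R "\<epsilon> / real L"
  proof unfold_locales
    fix i assume "i < length E"
    then have "is_top_ranking m k c q (E ! i) (R i)" using reports by blast
    from is_top_ranking_distinct[OF this]
    show "distinct (R i)" "length (R i) = k" "set (R i) \<subseteq> {1..m}" .
  qed (use assms in \<open>auto simp: L_def\<close>)
  have L: "L > 0" using assms(2-4) by (auto simp: L_def div_greater_zero_iff)
  have "real \<rho> * (\<epsilon> / real L) \<le> \<epsilon> / 2" if "\<rho> * k \<le> 4 * (m - 1)" for \<rho>
  proof -
    \<comment> \<open>As 2 \<rho> is an integer, rounding the quotient down to \<open>L\<close>
      loses nothing.\<close>
    have "2 * \<rho> \<le> L" using that assms(2) by (simp add: L_def less_eq_div_iff_mult_less_eq)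
    then have "real (2 * \<rho>) * \<epsilon> \<le> real L * \<epsilon>" using assms(1) by (intro mult_right_mono) linarith+
    then show ?thesis using L by (simp add: field_simps)
  qed
  then have "potential_within Q (\<epsilon> / 2) tops" by (rule potential_tops[OF assms(3,4)])
  then obtain g' where "g' \<in> {1..m}" "worst_case_regret m c E R g' \<le> ereal \<epsilon>"
    using exists_low_regret_candidate near by blast
  then show ?thesis
    using regret_le_worst_case[OF g consistent_true_quality[OF reports]] assms(1) by simp
qed

text \<open>The size is rounded down to an integer. For \<open>N = 1\<close> it is 0, and an empty
  committee bounds no difference of qualities; the last hypothesis therefore restricts that case to
  a single candidate.\<close>

theorem theorem4p1:
  fixes \<Theta> :: "'a::real_normed_vector set" and \<epsilon> :: real and m k N :: nat
  assumes "convex \<Theta>"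
    and "\<epsilon> > 0"
    and "1 \<le> k" and "k \<le> m"
    and "covering_number \<Theta> (\<epsilon> / 2) = enat N"
    and "N = 1 \<longrightarrow> m = 1"
  shows "\<exists>E :: 'a list. set E \<subseteq> \<Theta> \<and>
    length E = nat \<lfloor>(8 * (real m - 1) / real k + 1) * (real N - 1)\<rfloor> \<and>
    (\<forall>(c :: nat \<Rightarrow> 'a) (q :: nat \<Rightarrow> real) (R :: nat \<Rightarrow> nat list) (g :: nat).
       c ` {1..m} \<subseteq> \<Theta> \<longrightarrow>
       (\<forall>i<length E. is_top_ranking m k c q (E ! i) (R i)) \<longrightarrow>
       minimal_regret_candidate m c E R g \<longrightarrow>
       regret m q g \<le> \<epsilon>)"
proof -
  define n where "n = nat \<lfloor>(8 * (real m - 1) / real k + 1) * (real N - 1)\<rfloor>"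
  obtain X where X: "finite X" "is_cover \<Theta> (\<epsilon> / 2) X" "card X = N"
    using covering_number_attained[OF assms(5)] by blast
  have "X \<subseteq> \<Theta>" using X(2) by (simp add: is_cover_def)
  consider "N = 0" | "N \<ge> 1" "m = 1" | "N \<ge> 2" "m \<ge> 2" using assms(3,4,6) by linarith
  then have "\<exists>E :: 'a list. set E \<subseteq> \<Theta> \<and> length E = n \<and>
    (\<forall>c q R g. c ` {1..m} \<subseteq> \<Theta> \<longrightarrow> (\<forall>i<length E. is_top_ranking m k c q (E ! i) (R i)) \<longrightarrow>
       minimal_regret_candidate m c E R g \<longrightarrow> regret m q g \<le> \<epsilon>)"
  proof cases
    case 1
    then have "\<Theta> = {}" using X by (auto simp: is_cover_def)
    \<comment> \<open>The factor \<open>real N - 1\<close> is -1 here, and \<open>nat\<close> sends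
      the negative size to 0.\<close>
    moreover have "0 \<le> 8 * (real m - 1) / real k" using assms(3,4) by simp
    then have "n = 0" using 1 by (simp add: n_def)
    ultimately show ?thesis using assms(3,4) by auto
  next
    case 2
    then obtain x where "x \<in> X" using X by (metis card.empty ex_in_conv not_one_le_zero)
    then have "set (replicate n x) \<subseteq> \<Theta>" using \<open>X \<subseteq> \<Theta>\<close> by auto
    moreover have "regret m q g \<le> \<epsilon>"
      if "minimal_regret_candidate m c (replicate n x) R g" for c q R g
      using that regret_single_candidate 2 assms(2) by (metis less_imp_le)
    ultimately show ?thesis by (metis length_replicate)
  next
    case 3
    define L where "L = 8 * (m - 1) div k"
    have L: "L > 0" using 3 assms(3,4) by (auto simp: L_def div_greater_zero_iff)
    have "X \<noteq> {}" using X 3 by auto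
    then obtain S where S: "finite S" "S \<subseteq> \<Theta>" "X \<subseteq> S" "chained (\<epsilon> / real L) S"
      "card S \<le> L * (N - 1) + 1"
      using chained_superset_of_cover[OF assms(1) X(1,2) _ _ L] assms(2) X(3) by (metis less_imp_le)
    \<comment> \<open>As N \<ge> 2, the root of the tree fits into the extra summand N - 1.\<close>
    have "(L + 1) * (N - 1) = L * (N - 1) + (N - 1)" by simp
    then have "card S \<le> (L + 1) * (N - 1)" using S(5) 3 by linarith
    also have "\<dots> \<le> n"
    proof -
      have "real L \<le> 8 * (real m - 1) / real k"
        using of_nat_div_le_of_nat[of "8 * (m - 1)" k] 3 by (simp add: L_def of_nat_diff)
      then have "(real L + 1) * (real N - 1) \<le> (8 * (real m - 1) / real k + 1) * (real N - 1)"
        using 3 by (intro mult_right_mono) auto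
      moreover have "real ((L + 1) * (N - 1)) = (real L + 1) * (real N - 1)"
        using 3 by (simp only: of_nat_mult of_nat_add of_nat_diff) simp
      ultimately show ?thesis unfolding n_def by (simp add: le_nat_floor)
    qed
    finally obtain E where E: "set E = S" "length E = n"
      using obtain_list_of_length S(1,3) \<open>X \<noteq> {}\<close> by (metis subset_empty)
    have "regret m q g \<le> \<epsilon>"
      if "c ` {1..m} \<subseteq> \<Theta>" "\<forall>i<length E. is_top_ranking m k c q (E ! i) (R i)"
        "minimal_regret_candidate m c E R g" for c q R g
    proof (rule chained_committee_regret[OF assms(2-4) 3(2) _ _ _ that(2,3)])
      show "E \<noteq> []" using E(1) S(3) \<open>X \<noteq> {}\<close> by auto
      show "chained (\<epsilon> / real (8 * (m - 1) div k)) (set E)" using E(1) S(4) by (simp add: L_def)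
      show "\<exists>x\<in>set E. dist (c h) x \<le> \<epsilon> / 2" if "h \<in> {1..m}" for h
        using X(2) S(3) E(1) that \<open>c ` {1..m} \<subseteq> \<Theta>\<close> unfolding is_cover_def by blast
    qed
    then show ?thesis using E S(2) by blast
  qed
  then show ?thesis unfolding n_def .
qed

end
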